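(* Let $a(n)$ be a synchronizing $k$-automatic sequence with values in a finite alphabet $\mathcal A$. Then for every non-integer real number $c>1$, the frequencies of the letters of the sequence $(a(\lfloor n^c\rfloor))_{n\ge 0}$ exist and are equal to the corresponding frequencies of the letters of $(a(n))_{n\ge 0}$.
   Context: A sequence $a(n)$ with values in a finite alphabet $\mathcal A$ is $k$-automatic ($k\ge 2$ an integer) if it is the output sequence of a deterministic finite automaton with output, in which every state has $k$ outgoing edges labelled $0,1,\dots,k-1$, the input being the base-$k$ expansion of $n$ read starting with the most significant digit. Such a sequence is synchronizing if the (unique up to isomorphism) minimal automaton generating it has a synchronizing word, i.e. a word $w\in\{0,\dots,k-1\}^*$ such that reading $w$ leads to one and the same state regardless of the starting state. The frequency of a letter $\alpha$ in a sequence $b(n)$ is $\lim_{N\to\infty}\frac1N\#\{n<N: b(n)=\alpha\}$, when this limit exists. $\lfloor x\rfloor$ denotes the integer part of $x$. *)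

theory Defs
  imports Complex_Main
begin

record ('q, 'a) automaton =
  states :: "'q set"
  init :: 'q
  step :: "'q \<Rightarrow> nat \<Rightarrow> 'q"
  out :: "'q \<Rightarrow> 'a"

text \<open>Deterministic finite automata with output over the input alphabet \<open>{0, \<dots>, k - 1}\<close>.
  The values of \<open>step\<close> and \<open>out\<close> outside the states and the input alphabet are irrelevant.\<close>

definition dfao :: "nat \<Rightarrow> ('q, 'a) automaton \<Rightarrow> bool" where
  "dfao k M \<longleftrightarrow>
     finite (states M) \<and> init M \<in> states M \<and> (\<forall>q\<in>states M. \<forall>d<k. step M q d \<in> states M)"

definition run :: "('q, 'a) automaton \<Rightarrow> 'q \<Rightarrow> nat list \<Rightarrow> 'q" where
  "run M q w = foldl (step M) q w"

text \<open>The base-\<open>k\<close> expansion, most significant digit first and without leading zeros;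
  the expansion of \<open>0\<close> is the empty word. It is meaningful for \<open>k \<ge> 2\<close> only.\<close>

fun base_expansion :: "nat \<Rightarrow> nat \<Rightarrow> nat list" where
  "base_expansion k n =
     (if k < 2 \<or> n = 0 then [] else base_expansion k (n div k) @ [n mod k])"

declare base_expansion.simps [simp del]

lemma base_expansion_value:
  assumes "k \<ge> 2"
  shows "horner_sum (\<lambda>d. d) k (rev (base_expansion k n)) = n"
  using assms
proof (induction k n rule: base_expansion.induct)
  case (1 k n)
  then show ?case
    by (subst base_expansion.simps) auto
qed

definition generates :: "nat \<Rightarrow> ('q, 'a) automaton \<Rightarrow> (nat \<Rightarrow> 'a) \<Rightarrow> bool" where
  "generates k M a \<longleftrightarrow>
     dfao k M \<and> (\<forall>n. a n = out M (run M (init M) (base_expansion k n)))"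

text \<open>State sets are finite, so taking natural numbers as states is no restriction.\<close>

definition automatic :: "nat \<Rightarrow> (nat \<Rightarrow> 'a) \<Rightarrow> bool" where
  "automatic k a \<longleftrightarrow> (\<exists>M :: (nat, 'a) automaton. generates k M a)"

text \<open>The minimal automaton is the one with the fewest states among those that are insensitive
  to leading zeros, i.e. whose initial state has a loop labelled \<open>0\<close>. Without this
  convention the target of that edge may be left unconstrained by the generated sequence, and a
  generating automaton with the fewest states need not be unique up to isomorphism.\<close>

definition generates_lz :: "nat \<Rightarrow> ('q, 'a) automaton \<Rightarrow> (nat \<Rightarrow> 'a) \<Rightarrow> bool" where
  "generates_lz k M a \<longleftrightarrow> generates k M a \<and> step M (init M) 0 = init M"

definition minimal_automaton :: "nat \<Rightarrow> ('q, 'a) automaton \<Rightarrow> (nat \<Rightarrow> 'a) \<Rightarrow> bool" where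
  "minimal_automaton k M a \<longleftrightarrow>
     generates_lz k M a \<and>
     (\<forall>M' :: (nat, 'a) automaton. generates_lz k M' a \<longrightarrow> card (states M) \<le> card (states M'))"

definition synchronizing_word :: "nat \<Rightarrow> ('q, 'a) automaton \<Rightarrow> nat list \<Rightarrow> bool" where
  "synchronizing_word k M w \<longleftrightarrow>
     set w \<subseteq> {..<k} \<and> (\<exists>p. \<forall>q\<in>states M. run M q w = p)"

definition synchronizing :: "nat \<Rightarrow> (nat \<Rightarrow> 'a) \<Rightarrow> bool" where
  "synchronizing k a \<longleftrightarrow>
     (\<exists>M :: (nat, 'a) automaton. minimal_automaton k M a \<and> (\<exists>w. synchronizing_word k M w))"

definition has_frequency :: "(nat \<Rightarrow> 'a) \<Rightarrow> 'a \<Rightarrow> real \<Rightarrow> bool" where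
  "has_frequency b \<alpha> d \<longleftrightarrow>
     (\<lambda>N. real (card {n. n < N \<and> b n = \<alpha>}) / real N) \<longlonglongrightarrow> d"

end

theory Submission
  imports Defs "HOL-Analysis.Analysis" "HOL-Real_Asymp.Real_Asymp"
begin

text \<open>If the last \<open>m\<close> digits of \<open>n\<close> contain the synchronizing word, then \<open>a n\<close> depends on
  \<open>n mod k\<^sup>m\<close> only, and the proportion of residues modulo \<open>k\<^sup>m\<close> for which this fails
  tends to \<open>0\<close>. Hence \<open>a\<close> takes every value with the same frequency along all sequences of natural
  numbers that are equidistributed modulo every \<open>q\<close>. The sequence \<open>\<lfloor>n\<^sup>c\<rfloor>\<close> is such a
  sequence, because \<open>\<theta> n\<^sup>c\<close> is equidistributed modulo \<open>1\<close> for \<open>\<theta> \<noteq> 0\<close>: with \<open>j = \<lceil>c\<rceil>\<close>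
  its \<open>j\<close>-th differences decrease to \<open>0\<close> (for \<open>\<theta> > 0\<close>) more slowly than \<open>1 / n\<close>, and
  van der Corput's inequality reduces such a sequence to Fejer's case \<open>j = 1\<close>.\<close>

section \<open>Means of exponentials\<close>

definition avg :: "(nat \<Rightarrow> 'a::real_normed_field) \<Rightarrow> nat \<Rightarrow> 'a" where
  "avg u N = (\<Sum>n<N. u n) / of_nat N"

lemma norm_avg: "norm (avg u N) = norm (\<Sum>n<N. u n) / real N"
  by (simp add: avg_def norm_divide)

lemma norm_avg_le:
  assumes "\<And>n. norm (u n) \<le> 1"
  shows "norm (avg u N) \<le> 1"
proof -
  have "norm (\<Sum>n<N. u n) \<le> real (card {..<N}) * 1"
    by (rule sum_norm_bound) (use assms in auto)
  thus ?thesis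
    by (cases "N = 0") (auto simp: norm_avg divide_simps)
qed

lemma avg_add: "avg (\<lambda>n. f n + g n) N = avg f N + avg g N"
  by (simp add: avg_def sum.distrib add_divide_distrib)

lemma avg_cmult: "avg (\<lambda>n. c * f n) N = c * avg f N"
  by (simp add: avg_def flip: sum_distrib_left)

lemma avg_mono:
  fixes f g :: "nat \<Rightarrow> real"
  assumes "\<And>n. f n \<le> g n"
  shows "avg f N \<le> avg g N"
  unfolding avg_def by (intro divide_right_mono sum_mono assms) auto

text \<open>Each unit shift gains one term at the end and loses one at the start, so it costs at
  most 2.\<close>

lemma norm_sum_shift_le:
  fixes u :: "nat \<Rightarrow> 'a::real_normed_field"
  assumes "\<And>n. norm (u n) \<le> 1"
  shows "norm ((\<Sum>n<N. u (n + h)) - (\<Sum>n<N. u n)) \<le> 2 * real h"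
proof (induction h)
  case (Suc h)
  have eq: "(\<Sum>n<N. u (n + Suc h)) - (\<Sum>n<N. u (n + h)) = u (N + h) - u h"
    by (induction N) (auto simp: algebra_simps)
  have "(\<Sum>n<N. u (n + Suc h)) - (\<Sum>n<N. u n)
      = ((\<Sum>n<N. u (n + h)) - (\<Sum>n<N. u n)) + (u (N + h) - u h)"
    using eq by (simp add: algebra_simps)
  also have "norm \<dots> \<le> 2 * real h + (1 + 1)"
    by (intro norm_triangle_mono Suc norm_triangle_le_diff add_mono assms)
  finally show ?case by simp
qed auto

lemma avg_shift_diff:
  fixes u :: "nat \<Rightarrow> 'a::real_normed_field"
  assumes "\<And>n. norm (u n) \<le> 1"
  shows "(\<lambda>N. avg (\<lambda>n. u (n + h)) N - avg u N) \<longlonglongrightarrow> 0"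
proof (rule Lim_null_comparison)
  show "\<forall>\<^sub>F N in sequentially. norm (avg (\<lambda>n. u (n + h)) N - avg u N) \<le> 2 * real h / real N"
    using norm_sum_shift_le[where u = u and h = h, OF assms]
    by (intro always_eventually allI)
       (auto simp: avg_def norm_divide simp flip: diff_divide_distrib intro!: divide_right_mono)
  show "(\<lambda>N. 2 * real h / real N) \<longlonglongrightarrow> 0"
    by real_asymp
qed

lemma avg_shift_iff:
  fixes u :: "nat \<Rightarrow> 'a::real_normed_field"
  assumes "\<And>n. norm (u n) \<le> 1"
  shows "avg (\<lambda>n. u (n + h)) \<longlonglongrightarrow> L \<longleftrightarrow> avg u \<longlonglongrightarrow> L"
  using avg_shift_diff[of u h, OF assms] by (rule Lim_transform_eq)

text \<open>Beyond \<open>n0\<close> the terms are below \<open>\<epsilon> / 2\<close>, and the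
  fixed contribution \<open>K\<close> of the earlier ones vanishes after division by
  \<open>N\<close>.\<close>

lemma avg_tendsto_0:
  fixes d :: "nat \<Rightarrow> real"
  assumes "d \<longlonglongrightarrow> 0"
  shows "avg d \<longlonglongrightarrow> 0"
proof (rule tendstoI, unfold norm_conv_dist[symmetric])
  fix \<epsilon> :: real assume \<epsilon>: "\<epsilon> > 0"
  from assms have "\<forall>\<^sub>F n in sequentially. norm (d n) < \<epsilon> / 2"
    using \<epsilon> by (auto simp: tendsto_iff dest!: spec[of _ "\<epsilon> / 2"])
  then obtain n0 where n0: "norm (d n) < \<epsilon> / 2" if "n \<ge> n0" for n
    by (auto simp: eventually_at_top_linorder)
  define K where "K = (\<Sum>n<n0. norm (d n))"
  have bound: "norm (\<Sum>n<N. d n) \<le> K + real N * (\<epsilon> / 2)" for N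
  proof -
    have "norm (\<Sum>n<N. d n) \<le> (\<Sum>n<N. norm (d n))"
      by (rule norm_sum)
    also have "\<dots> \<le> (\<Sum>n<N. (if n < n0 then norm (d n) else 0) + \<epsilon> / 2)"
      using n0 \<epsilon> by (intro sum_mono) (auto simp: not_less intro: less_imp_le)
    also have "\<dots> = (\<Sum>n\<in>{..<N} \<inter> {..<n0}. norm (d n)) + real N * (\<epsilon> / 2)"
      by (simp add: sum.distrib sum.inter_restrict cong: if_cong)
    also have "(\<Sum>n\<in>{..<N} \<inter> {..<n0}. norm (d n)) \<le> K"
      unfolding K_def by (intro sum_mono2) auto
    finally show ?thesis by simp
  qed
  have "\<forall>\<^sub>F N in sequentially. K / real N < \<epsilon> / 2"
    using \<epsilon> by (intro order_tendstoD(2)[where y = 0]) (real_asymp | simp)+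
  with eventually_gt_at_top[of 0] show "\<forall>\<^sub>F N in sequentially. norm (avg d N) < \<epsilon>"
  proof eventually_elim
    case (elim N)
    have "norm (avg d N) \<le> (K + real N * (\<epsilon> / 2)) / real N"
      unfolding norm_avg by (intro divide_right_mono bound) auto
    also have "\<dots> = K / real N + \<epsilon> / 2"
      using elim by (simp add: field_simps)
    finally show ?case using elim by linarith
  qed
qed

section \<open>Van der Corput's inequality\<close>

lemma norm_avg_squared_le:
  "norm (avg (v :: nat \<Rightarrow> complex) N) ^ 2 \<le> avg (\<lambda>n. norm (v n) ^ 2) N"
proof (cases "N = 0")
  case False
  have "norm (\<Sum>n<N. v n) ^ 2 \<le> (\<Sum>n<N. norm (v n)) ^ 2"
    by (intro power_mono norm_sum) auto
  also have "\<dots> \<le> real N * (\<Sum>n<N. norm (v n) ^ 2)"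
    using Cauchy_Schwarz_ineq_sum[of "\<lambda>_. 1" "\<lambda>n. norm (v n)" "{..<N}"] by simp
  finally have "norm (\<Sum>n<N. v n) ^ 2 / real N ^ 2 \<le> real N * (\<Sum>n<N. norm (v n) ^ 2) / real N ^ 2"
    by (intro divide_right_mono) auto
  also have "\<dots> = (\<Sum>n<N. norm (v n) ^ 2) / real N"
    using False by (simp add: power2_eq_square)
  finally show ?thesis
    by (simp add: norm_avg avg_def[of "\<lambda>n. norm (v n) ^ 2"] power_divide)
qed (simp add: avg_def)

text \<open>Up to an error \<open>O(H / N)\<close> the mean of \<open>u\<close> is the mean of its averages over windows of length
  \<open>H\<close>. By Cauchy--Schwarz the latter is controlled by the correlations of \<open>u\<close>, of which only the
  \<open>H\<close> diagonal ones out of \<open>H\<^sup>2\<close> survive in the limit.\<close>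

lemma van_der_Corput:
  fixes u :: "nat \<Rightarrow> complex"
  assumes u: "\<And>n. norm (u n) \<le> 1"
  assumes corr: "\<And>h. h > 0 \<Longrightarrow> avg (\<lambda>n. u (n + h) * cnj (u n)) \<longlonglongrightarrow> 0"
  shows "avg u \<longlonglongrightarrow> 0"
proof (rule tendstoI, unfold norm_conv_dist[symmetric])
  fix \<epsilon> :: real assume \<epsilon>: "\<epsilon> > 0"
  have "\<forall>\<^sub>F H in sequentially. sqrt (2 / real H) < \<epsilon> / 2 \<and> H > 0"
    using \<epsilon> by (intro eventually_conj order_tendstoD(2)[where y = 0] eventually_gt_at_top) (real_asymp | simp)+
  \<comment> \<open>\<open>sqrt (2 / H)\<close> is the eventual bound for the mean of
    \<open>v\<close> divided by \<open>H\<close>: the mean of \<open>norm (v n) ^ 2\<close> will be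
    at most \<open>2 * H\<close>, one \<open>H\<close> coming from the diagonal correlations and one
    from all the others.\<close>
  then obtain H where H: "H > 0" "sqrt (2 / real H) < \<epsilon> / 2"
    by (auto simp: eventually_at_top_linorder)
  define v where "v n = (\<Sum>h<H. u (n + h))" for n
  define C where "C i j N = avg (\<lambda>n. u (n + i) * cnj (u (n + j))) N" for i j N
  have uu: "norm (u i * cnj (u j)) \<le> 1" for i j
    using u[of i] u[of j] by (simp add: norm_mult mult_le_one)
  have C_le: "norm (C i j N) \<le> 1" for i j N
    unfolding C_def by (rule norm_avg_le) (rule uu)
  have C_gt: "C i j \<longlonglongrightarrow> 0" if "j < i" for i j
  proof -
    have "avg (\<lambda>n. u (n + j + (i - j)) * cnj (u (n + j))) \<longlonglongrightarrow> 0"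
      using avg_shift_iff[of "\<lambda>n. u (n + (i - j)) * cnj (u n)" j 0] corr[of "i - j"] uu that by auto
    thus ?thesis using that by (simp add: C_def[abs_def])
  qed
  have C_cnj: "C i j N = cnj (C j i N)" for i j N
    by (simp add: C_def avg_def mult.commute)
  have C_lim: "C i j \<longlonglongrightarrow> 0" if "i \<noteq> j" for i j
  proof (cases "j < i")
    case False
    hence "(\<lambda>N. cnj (C j i N)) \<longlonglongrightarrow> cnj 0"
      using that by (intro tendsto_cnj C_gt) auto
    thus ?thesis by (simp flip: C_cnj)
  qed (use C_gt in auto)
  have v_sq: "avg (\<lambda>n. norm (v n) ^ 2) N \<le> real H + (\<Sum>i<H. \<Sum>j\<in>{..<H}-{i}. norm (C i j N))" for N
  proof -
    have "complex_of_real (avg (\<lambda>n. norm (v n) ^ 2) N) = avg (\<lambda>n. v n * cnj (v n)) N"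
      by (simp add: avg_def complex_norm_square del: of_real_power)
    also have "\<dots> = (\<Sum>i<H. \<Sum>j<H. C i j N)"
      unfolding avg_def C_def v_def
      by (simp add: sum_product sum_divide_distrib sum.swap[of _ "{..<N}"])
    finally have "norm (avg (\<lambda>n. norm (v n) ^ 2) N) = norm (\<Sum>i<H. \<Sum>j<H. C i j N)"
      by (metis norm_of_real real_norm_def)
    also have "\<dots> \<le> (\<Sum>i<H. \<Sum>j<H. norm (C i j N))"
      by (intro order.trans[OF norm_sum] sum_mono norm_sum)
    also have "\<dots> = (\<Sum>i<H. norm (C i i N) + (\<Sum>j\<in>{..<H}-{i}. norm (C i j N)))"
      by (intro sum.cong refl sum.remove) auto
    also have "\<dots> \<le> (\<Sum>i<H. 1 + (\<Sum>j\<in>{..<H}-{i}. norm (C i j N)))"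
      by (intro sum_mono add_right_mono C_le)
    finally show ?thesis by (simp add: sum.distrib)
  qed
  have "(\<lambda>N. \<Sum>i<H. \<Sum>j\<in>{..<H}-{i}. norm (C i j N)) \<longlonglongrightarrow> (\<Sum>i<H. \<Sum>j\<in>{..<H}-{i}. 0)"
    by (intro tendsto_sum tendsto_norm_zero C_lim) auto
  hence "\<forall>\<^sub>F N in sequentially. (\<Sum>i<H. \<Sum>j\<in>{..<H}-{i}. norm (C i j N)) < real H"
    using H by (intro order_tendstoD(2)) auto
  moreover have "\<forall>\<^sub>F N in sequentially. 2 * real H / real N < \<epsilon> / 2"
    using \<epsilon> by (intro order_tendstoD(2)[where y = 0]) (real_asymp | simp)+
  ultimately show "\<forall>\<^sub>F N in sequentially. norm (avg u N) < \<epsilon>"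
  proof eventually_elim
    case (elim N)
    have "norm (avg v N) ^ 2 \<le> 2 * real H"
      using norm_avg_squared_le[of v N] v_sq[of N] elim by linarith
    hence "norm (avg v N) \<le> sqrt (2 * real H)"
      by (rule real_le_rsqrt)
    hence "norm (avg v N) / real H \<le> sqrt (2 * real H) / real H"
      by (intro divide_right_mono) auto
    also have "sqrt (2 * real H) / real H = sqrt (2 / real H)"
      using H by (simp add: real_sqrt_mult real_sqrt_divide field_simps)
    finally have v1: "norm (avg v N) / real H < \<epsilon> / 2"
      using H by linarith
    have "avg v N = (\<Sum>h<H. avg (\<lambda>n. u (n + h)) N)"
      unfolding avg_def v_def by (simp add: sum_divide_distrib sum.swap[of _ "{..<N}"])
    hence "norm (avg v N - of_nat H * avg u N) = norm (\<Sum>h<H. avg (\<lambda>n. u (n + h)) N - avg u N)"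
      by (simp add: sum_subtractf)
    also have "\<dots> \<le> real (card {..<H}) * (2 * real H / real N)"
    proof (rule sum_norm_bound)
      fix h assume "h \<in> {..<H}"
      have "norm (avg (\<lambda>n. u (n + h)) N - avg u N) \<le> 2 * real h / real N"
        using norm_sum_shift_le[where u = u and h = h and N = N, OF u]
        by (auto simp: avg_def norm_divide simp flip: diff_divide_distrib intro!: divide_right_mono)
      also have "\<dots> \<le> 2 * real H / real N"
        using \<open>h \<in> {..<H}\<close> by (intro divide_right_mono) auto
      finally show "norm (avg (\<lambda>n. u (n + h)) N - avg u N) \<le> 2 * real H / real N" .
    qed
    finally have "norm (avg v N - of_nat H * avg u N) / real H \<le> 2 * real H / real N"
      using H by (simp add: field_simps)
    moreover have "norm (of_nat H * avg u N) \<le> norm (avg v N) + norm (avg v N - of_nat H * avg u N)"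
      by (metis norm_minus_commute norm_triangle_sub)
    hence "norm (avg u N) \<le> norm (avg v N) / real H + norm (avg v N - of_nat H * avg u N) / real H"
      using H by (simp add: norm_mult field_simps)
    ultimately show ?case using v1 elim by linarith
  qed
qed

section \<open>Fejer's theorem and its extension to higher differences\<close>

definition fdiff :: "('b::{plus,one} \<Rightarrow> real) \<Rightarrow> 'b \<Rightarrow> real" where
  "fdiff f x = f (x + 1) - f x"

lemma norm_cis_minus_linear_le: "norm (cis t - 1 - \<i> * of_real t) \<le> t\<^sup>2"
  using Taylor_exp[of "\<i> * of_real t" 1]
  by (simp add: cis_conv_exp norm_mult power2_eq_square algebra_simps)

text \<open>To first order \<open>e (Suc n) - e n\<close> is
  \<open>2 * pi * \<i> * d n * e n\<close>. Dividing by \<open>d n\<close> turns the sum of the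
  \<open>e n\<close>, up to a constant factor, into a sum of increments weighted by the monotone
  \<open>g = 1 / d\<close>, with an error of the order of the sum of the \<open>d n\<close>.
  Summation by parts bounds the weighted sum by \<open>2 * g N\<close>, and \<open>g N / N\<close>
  tends to 0 by the growth hypothesis.\<close>

lemma Fejer_fdiff:
  fixes x :: "nat \<Rightarrow> real"
  assumes dec: "decseq (fdiff x)"
    and lim: "fdiff x \<longlonglongrightarrow> 0"
    and inf: "filterlim (\<lambda>n. real n * fdiff x n) at_top sequentially"
  shows "avg (\<lambda>n. cis (2 * pi * x n)) \<longlonglongrightarrow> 0"
proof -
  define d where "d = fdiff x"
  define e where "e n = cis (2 * pi * x n)" for n
  define g where "g n = 1 / d n" for n
  \<comment> \<open>Positivity at some later index passes back to \<open>n\<close> by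
    monotonicity.\<close>
  have d_pos: "d n > 0" for n
  proof -
    have "\<forall>\<^sub>F m in sequentially. real m * d m > 0 \<and> m \<ge> n"
      using inf[unfolded filterlim_at_top_dense, rule_format, of 0] unfolding d_def
      by (intro eventually_conj eventually_ge_at_top)
    then obtain m where m: "real m * d m > 0" "m \<ge> n"
      using eventually_happens[of _ sequentially] by auto
    have "d m \<le> d n"
      using dec m(2) unfolding d_def decseq_def by blast
    with m show ?thesis by (auto simp: zero_less_mult_iff)
  qed
  have g_mono: "g n \<le> g (Suc n)" for n
    using decseqD[OF dec, of n "Suc n"] d_pos unfolding g_def d_def[symmetric]
    by (intro divide_left_mono) auto
  have g_pos: "g n > 0" for n
    using d_pos by (simp add: g_def)
  have e_Suc: "e (Suc n) = e n * cis (2 * pi * d n)" for n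
    by (simp add: e_def d_def fdiff_def cis_mult algebra_simps)
  have Abel: "(\<Sum>n<N. (e (Suc n) - e n) * g n) =
      e N * g N - e 0 * g 0 - (\<Sum>n<N. e (Suc n) * (g (Suc n) - g n))" for N
    by (induction N) (auto simp: algebra_simps)
  \<comment> \<open>Since \<open>g\<close> increases, its variation telescopes to
    \<open>g N - g 0\<close>; the two boundary terms add \<open>g N + g 0\<close>.\<close>
  have Abel_le: "norm (\<Sum>n<N. (e (Suc n) - e n) * g n) \<le> 2 * g N" for N
  proof -
    have "norm (e (Suc n) * (g (Suc n) - g n)) = g (Suc n) - g n" for n
      using g_mono[of n] by (simp add: norm_mult e_def flip: of_real_diff)
    hence "norm (\<Sum>n<N. e (Suc n) * (g (Suc n) - g n)) \<le> (\<Sum>n<N. g (Suc n) - g n)"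
      by (intro sum_norm_le) simp
    hence 1: "norm (\<Sum>n<N. e (Suc n) * (g (Suc n) - g n)) \<le> g N - g 0"
      by (simp add: sum_lessThan_telescope)
    have 2: "norm (e n * g n) = g n" for n
      using g_pos[of n] by (simp add: norm_mult e_def)
    show ?thesis
      unfolding Abel using 1 2[of N] 2[of 0]
        norm_triangle_ineq4[of "e N * g N - e 0 * g 0" "\<Sum>n<N. e (Suc n) * (g (Suc n) - g n)"]
        norm_triangle_ineq4[of "e N * g N" "e 0 * g 0"]
      by linarith
  qed
  have term_le: "norm (2 * pi * \<i> * e n - (e (Suc n) - e n) * g n) \<le> 4 * pi\<^sup>2 * d n" for n
  proof -
    have "2 * pi * \<i> * e n - (e (Suc n) - e n) * g n
        = - (e n * g n * (cis (2 * pi * d n) - 1 - \<i> * of_real (2 * pi * d n)))"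
      using d_pos[of n] by (simp add: e_Suc g_def field_simps)
    also have "norm \<dots> = g n * norm (cis (2 * pi * d n) - 1 - \<i> * of_real (2 * pi * d n))"
      using g_pos[of n] by (simp add: norm_mult e_def del: of_real_mult)
    also have "\<dots> \<le> g n * (2 * pi * d n)\<^sup>2"
      using g_pos[of n] by (intro mult_left_mono norm_cis_minus_linear_le) auto
    also have "\<dots> = 4 * pi\<^sup>2 * d n"
      using d_pos[of n] by (simp add: g_def power2_eq_square)
    finally show ?thesis .
  qed
  have bound: "norm (avg e N) \<le> g N / real N / pi + 2 * pi * avg d N" for N
  proof -
    have "norm (2 * pi * \<i> * (\<Sum>n<N. e n) - (\<Sum>n<N. (e (Suc n) - e n) * g n))
        = norm (\<Sum>n<N. 2 * pi * \<i> * e n - (e (Suc n) - e n) * g n)"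
      by (simp add: sum_subtractf sum_distrib_left)
    also have "\<dots> \<le> (\<Sum>n<N. 4 * pi\<^sup>2 * d n)"
      by (intro sum_norm_le term_le)
    finally have "norm (2 * pi * \<i> * (\<Sum>n<N. e n)) \<le> 2 * g N + 4 * pi\<^sup>2 * (\<Sum>n<N. d n)"
      using Abel_le[of N]
        norm_triangle_ineq2[of "2 * pi * \<i> * (\<Sum>n<N. e n)" "\<Sum>n<N. (e (Suc n) - e n) * g n"]
      by (simp add: sum_distrib_left)
    hence "norm (\<Sum>n<N. e n) \<le> g N / pi + 2 * pi * (\<Sum>n<N. d n)"
      by (simp add: norm_mult field_simps power2_eq_square)
    hence "norm (avg e N) \<le> (g N / pi + 2 * pi * (\<Sum>n<N. d n)) / real N"
      unfolding norm_avg by (intro divide_right_mono) auto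
    thus ?thesis by (simp add: avg_def add_divide_distrib mult.commute[of pi "real N"])
  qed
  have lim0: "(\<lambda>N. g N / real N / pi + 2 * pi * avg d N) \<longlonglongrightarrow> 0 / pi + 2 * pi * 0"
  proof (intro tendsto_intros avg_tendsto_0)
    have "(\<lambda>N. inverse (real N * d N)) \<longlonglongrightarrow> 0"
      using inf unfolding d_def by (rule tendsto_inverse_0_at_top)
    thus "(\<lambda>N. g N / real N) \<longlonglongrightarrow> 0"
      by (simp add: g_def field_simps)
  qed (use lim in \<open>auto simp: d_def\<close>)
  show ?thesis
    unfolding e_def[symmetric]
    by (rule Lim_null_comparison[of _ "\<lambda>N. g N / real N / pi + 2 * pi * avg d N"])
       (use bound lim0 in auto)
qed

text \<open>The phase of a correlation at lag \<open>h\<close> is \<open>x (n + h) - x n\<close>.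
  Differencing commutes with shifts, and telescoping over \<open>h\<close> unit steps gains one
  order of differences.\<close>

lemma funpow_fdiff_shift_diff:
  fixes x :: "nat \<Rightarrow> real"
  shows "(fdiff ^^ j) (\<lambda>n. x (n + h) - x n) n = (\<Sum>i<h. (fdiff ^^ Suc j) x (n + i))"
proof -
  have "(fdiff ^^ j) (\<lambda>n. x (n + h) - x n) n = (fdiff ^^ j) x (n + h) - (fdiff ^^ j) x n"
  proof (induction j arbitrary: n)
    case (Suc j)
    show ?case using Suc[of n] Suc[of "n + 1"] by (simp add: fdiff_def)
  qed auto
  also have "\<dots> = (\<Sum>i<h. (fdiff ^^ Suc j) x (n + i))"
    by (induction h) (auto simp: fdiff_def)
  finally show ?thesis .
qed

text \<open>Induction on \<open>j\<close> with Fejer's theorem as base. The correlations demanded by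
  van der Corput's inequality have phases whose differences of order \<open>Suc j\<close> are sums
  of \<open>h\<close> shifts of \<open>D\<close>, and such sums inherit all three
  conditions.\<close>

lemma avg_cis_funpow_fdiff:
  fixes x :: "nat \<Rightarrow> real"
  assumes "decseq ((fdiff ^^ Suc j) x)"
    and "(fdiff ^^ Suc j) x \<longlonglongrightarrow> 0"
    and "filterlim (\<lambda>n. real n * (fdiff ^^ Suc j) x n) at_top sequentially"
  shows "avg (\<lambda>n. cis (2 * pi * x n)) \<longlonglongrightarrow> 0"
  using assms
proof (induction j arbitrary: x)
  case 0
  thus ?case by (intro Fejer_fdiff) auto
next
  case (Suc j)
  define D where "D = (fdiff ^^ Suc (Suc j)) x"
  have D: "decseq D" "D \<longlonglongrightarrow> 0" "filterlim (\<lambda>n. real n * D n) at_top sequentially"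
    using Suc.prems by (simp_all add: D_def del: funpow.simps)
  have D_nonneg: "D n \<ge> 0" for n
    using D(1,2) by (rule decseq_ge)
  show ?case
  proof (rule van_der_Corput)
    fix h :: nat assume h: "h > 0"
    define y where "y = (\<lambda>n. x (n + h) - x n)"
    have y: "(fdiff ^^ Suc j) y = (\<lambda>n. \<Sum>i<h. D (n + i))"
      unfolding y_def D_def by (rule ext) (rule funpow_fdiff_shift_diff)
    have "avg (\<lambda>n. cis (2 * pi * y n)) \<longlonglongrightarrow> 0"
    proof (rule Suc.IH; unfold y)
      show "decseq (\<lambda>n. \<Sum>i<h. D (n + i))"
        using D(1) by (auto simp: decseq_def intro!: sum_mono)
      have "(\<lambda>n. \<Sum>i<h. D (n + i)) \<longlonglongrightarrow> (\<Sum>i<h. 0)"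
        using D(2) by (intro tendsto_sum) (rule LIMSEQ_ignore_initial_segment)
      thus "(\<lambda>n. \<Sum>i<h. D (n + i)) \<longlonglongrightarrow> 0" by simp
      \<comment> \<open>The summand \<open>i = 0\<close> alone grows fast enough, the others being
        nonnegative.\<close>
      have "D n \<le> (\<Sum>i<h. D (n + i))" for n
        using member_le_sum[of 0 "{..<h}" "\<lambda>i. D (n + i)"] h D_nonneg by auto
      thus "filterlim (\<lambda>n. real n * (\<Sum>i<h. D (n + i))) at_top sequentially"
        by (intro filterlim_at_top_mono[OF D(3)] always_eventually allI mult_left_mono) auto
    qed
    thus "avg (\<lambda>n. cis (2 * pi * x (n + h)) * cnj (cis (2 * pi * x n))) \<longlonglongrightarrow> 0"
      by (simp add: y_def cis_cnj cis_mult algebra_simps)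
  qed auto
qed

section \<open>Iterated differences of real powers\<close>

lemma funpow_fdiff_MVT:
  fixes F :: "nat \<Rightarrow> real \<Rightarrow> real"
  assumes "\<And>i x. x > 0 \<Longrightarrow> (F i has_real_derivative F (Suc i) x) (at x)" and "x > 0"
  shows "\<exists>\<xi>. x \<le> \<xi> \<and> \<xi> \<le> x + real j \<and> (fdiff ^^ j) (F 0) x = F j \<xi>"
  using assms(1)
proof (induction j arbitrary: F)
  case (Suc j)
  have "\<exists>\<xi>. x \<le> \<xi> \<and> \<xi> \<le> x + real j \<and> (fdiff ^^ j) (fdiff (F 0)) x = fdiff (F j) \<xi>"
  \<comment> \<open>A whole chain of derivatives is assumed so that the induction can pass to the
    chain of differences \<open>fdiff (F i)\<close>. The mean value theorem then turns the one
    remaining difference into a derivative, moving the point by less than 1.\<close>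
  proof (rule Suc.IH[of "\<lambda>i. fdiff (F i)"])
    fix i :: nat and y :: real assume "y > 0"
    hence "((\<lambda>y. F i (y + 1)) has_real_derivative F (Suc i) (y + 1)) (at y)"
      using Suc.prems[of "y + 1" i] by (simp add: DERIV_shift)
    thus "(fdiff (F i) has_real_derivative fdiff (F (Suc i)) y) (at y)"
      unfolding fdiff_def[abs_def] using \<open>y > 0\<close> by (intro DERIV_diff Suc.prems)
  qed
  then obtain \<xi> where \<xi>: "x \<le> \<xi>" "\<xi> \<le> x + real j" "(fdiff ^^ Suc j) (F 0) x = fdiff (F j) \<xi>"
    by (auto simp: funpow_swap1)
  have "\<exists>z>\<xi>. z < \<xi> + 1 \<and> F j (\<xi> + 1) - F j \<xi> = (\<xi> + 1 - \<xi>) * F (Suc j) z"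
    using \<xi>(1) \<open>x > 0\<close> by (intro MVT2 Suc.prems) auto
  then obtain z where "z > \<xi>" "z < \<xi> + 1" "fdiff (F j) \<xi> = F (Suc j) z"
    by (auto simp: fdiff_def)
  with \<xi> show ?case by (intro exI[of _ z]) auto
qed auto

text \<open>\<open>fdiff\<close> is polymorphic in its argument type for the sake of this
  comparison. The offset 1 keeps the arguments positive, where powers are differentiable.\<close>

lemma funpow_fdiff_of_nat:
  fixes f :: "real \<Rightarrow> real"
  shows "(fdiff ^^ j) (\<lambda>n::nat. f (real n + 1)) n = (fdiff ^^ j) f (real n + 1)"
proof (induction j arbitrary: n)
  case (Suc j)
  show ?case using Suc[of n] Suc[of "n + 1"] by (simp add: fdiff_def add_ac)
qed auto

text \<open>The differences of order \<open>Suc j = \<lceil>c\<rceil>\<close> behave like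
  \<open>K * n powr s\<close> with \<open>-1 < s < 0\<close>: they tend to 0 since
  \<open>s < 0\<close>, and \<open>n\<close> times them tends to infinity since
  \<open>s > -1\<close>. For integral \<open>c\<close> the exponent would be
  \<open>-1\<close>.\<close>

lemma avg_cis_powr_pos:
  fixes c \<theta> :: real
  assumes c: "c > 0" "c \<notin> \<int>" and \<theta>: "\<theta> > 0"
  shows "avg (\<lambda>n. cis (2 * pi * (\<theta> * real n powr c))) \<longlonglongrightarrow> 0"
proof -
  define j where "j = nat \<lfloor>c\<rfloor>"
  define s where "s = c - real (Suc j)"
  have "c \<noteq> real j"
    using c(2) by (metis Ints_of_nat)
  hence s: "s < 0" "s > -1" and jc: "real j < c"
    using c(1) unfolding s_def j_def by linarith+
  \<comment> \<open>\<open>C i\<close> is \<open>\<theta>\<close> times a falling factorial of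
    \<open>c\<close>, so \<open>F i\<close> is the \<open>i\<close>-th derivative of
    \<open>\<theta> * x powr c\<close>.\<close>
  define C where "C i = \<theta> * (\<Prod>l<i. c - real l)" for i
  define F where "F i x = C i * x powr (c - real i)" for i x
  have F_deriv: "(F i has_real_derivative F (Suc i) x) (at x)" if "x > 0" for i x
  proof -
    have "(F i has_real_derivative C i * ((c - real i) * x powr (c - real i - 1))) (at x)"
      unfolding F_def[abs_def] using that by (intro DERIV_cmult has_real_derivative_powr)
    thus ?thesis by (simp add: F_def C_def algebra_simps)
  qed
  define x where "x = (\<lambda>n. \<theta> * (real n + 1) powr c)"
  have x_eq: "x = (\<lambda>n. F 0 (real n + 1))"
    by (simp add: x_def F_def C_def)
  have diff: "\<exists>\<xi>\<ge>real n + 1. \<xi> \<le> real n + 1 + real i \<and> (fdiff ^^ i) x n = F i \<xi>" for n i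
    using funpow_fdiff_MVT[of F "real n + 1" i, OF F_deriv]
    unfolding x_eq funpow_fdiff_of_nat by auto
  define D where "D = (fdiff ^^ Suc j) x"
  define K where "K = C (Suc j)"
  have K: "K > 0"
    unfolding K_def C_def using jc \<theta> by (intro mult_pos_pos prod_pos) auto
  \<comment> \<open>The intermediate point lies between \<open>n + 1\<close> and
    \<open>n + 2 + j\<close>, and a negative power is decreasing.\<close>
  have D_le: "D n \<le> K * (real n + 1) powr s" and D_ge: "D n \<ge> K * (real n + 2 + real j) powr s" for n
  proof -
    from diff[of n "Suc j"] obtain \<xi>
      where \<xi>: "\<xi> \<ge> real n + 1" "\<xi> \<le> real n + 2 + real j" "D n = K * \<xi> powr s"
      unfolding D_def F_def K_def s_def by (auto simp: algebra_simps simp del: funpow.simps)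
    show "D n \<le> K * (real n + 1) powr s" "D n \<ge> K * (real n + 2 + real j) powr s"
      unfolding \<xi>(3) using \<xi>(1,2) K s by (intro mult_left_mono powr_mono2'; simp)+
  qed
  have "avg (\<lambda>n. cis (2 * pi * x n)) \<longlonglongrightarrow> 0"
  proof (rule avg_cis_funpow_fdiff[of j]; unfold D_def[symmetric])
    show "decseq D"
    proof (rule decseq_SucI)
      fix n
      from diff[of n "Suc (Suc j)"] obtain \<xi> where \<xi>: "fdiff D n = F (Suc (Suc j)) \<xi>"
        unfolding D_def by auto
      \<comment> \<open>The next coefficient acquires the negative factor \<open>s\<close>, which
        makes \<open>D\<close> decreasing.\<close>
      have "C (Suc (Suc j)) = K * s"
        by (simp add: K_def C_def s_def)
      hence "C (Suc (Suc j)) \<le> 0"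
        using K s by (simp add: mult_nonneg_nonpos)
      hence "fdiff D n \<le> 0"
        unfolding \<xi> F_def by (intro mult_nonpos_nonneg) auto
      thus "D (Suc n) \<le> D n" by (simp add: fdiff_def)
    qed
    have D_nonneg: "D n \<ge> 0" for n
      using D_ge[of n] K by (meson order_trans mult_nonneg_nonneg less_imp_le powr_ge_zero)
    have "(\<lambda>n. K * (real n + 1) powr s) \<longlonglongrightarrow> 0"
      using s by real_asymp
    thus "D \<longlonglongrightarrow> 0"
      by (rule Lim_null_comparison[rotated]) (use D_le D_nonneg in auto)
    have "filterlim (\<lambda>n. real n * (K * (real n + 2 + real j) powr s)) at_top sequentially"
      using s K by real_asymp
    thus "filterlim (\<lambda>n. real n * D n) at_top sequentially"
      by (rule filterlim_at_top_mono) (intro always_eventually allI mult_left_mono D_ge; simp)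
  qed
  thus ?thesis
    using avg_shift_iff[of "\<lambda>n. cis (2 * pi * (\<theta> * real n powr c))" 1 0]
    by (simp add: x_def add.commute)
qed

lemma avg_cis_powr:
  fixes c \<theta> :: real
  assumes c: "c > 0" "c \<notin> \<int>" and \<theta>: "\<theta> \<noteq> 0"
  shows "avg (\<lambda>n. cis (2 * pi * (\<theta> * real n powr c))) \<longlonglongrightarrow> 0"
proof (cases "\<theta> > 0")
  case False
  have "avg (\<lambda>n. cis (2 * pi * ((-\<theta>) * real n powr c))) \<longlonglongrightarrow> 0"
    using False assms by (intro avg_cis_powr_pos) auto
  hence "(\<lambda>N. cnj (avg (\<lambda>n. cis (2 * pi * ((-\<theta>) * real n powr c))) N)) \<longlonglongrightarrow> cnj 0"
    by (rule tendsto_cnj)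
  thus ?thesis by (simp add: avg_def[abs_def] cis_cnj)
qed (use avg_cis_powr_pos assms in auto)

section \<open>Equidistribution\<close>

lemma avg_const: "N > 0 \<Longrightarrow> avg (\<lambda>_. z) N = z"
  by (simp add: avg_def)

text \<open>Only sums of monomials are generated, so that Weyl's statement follows by linearity;
  closure under products is proved separately, for the sake of Stone-Weierstrass
  approximation.\<close>

inductive trig_poly :: "(real \<Rightarrow> complex) \<Rightarrow> bool" where
  monom: "trig_poly (\<lambda>t. z * cis (2 * pi * (of_int m * t)))"
| add: "trig_poly f \<Longrightarrow> trig_poly g \<Longrightarrow> trig_poly (\<lambda>t. f t + g t)"

lemma trig_poly_mult:
  assumes "trig_poly f" "trig_poly g"
  shows "trig_poly (\<lambda>t. f t * g t)"
  using assms(1)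
proof induction
  case (monom z m)
  show ?case
    using assms(2)
  proof induction
    case (monom w l)
    have "(\<lambda>t. z * cis (2 * pi * (of_int m * t)) * (w * cis (2 * pi * (of_int l * t))))
        = (\<lambda>t. (z * w) * cis (2 * pi * (of_int (m + l) * t)))"
      by (rule ext) (simp add: ring_distribs flip: cis_mult)
    with trig_poly.monom[of "z * w" "m + l"] show ?case by (simp only:)
  next
    case (add f g)
    from trig_poly.add[OF this(3,4)] show ?case by (simp only: distrib_left)
  qed
next
  case (add f g)
  from trig_poly.add[OF this(3,4)] show ?case by (simp only: distrib_right)
qed

text \<open>Connects Stone-Weierstrass approximation with exponential means: on the circle a
  real-linear form has only the frequencies 1 and -1, and products add frequencies.\<close>

lemma trig_poly_real_polynomial_function:
  assumes "real_polynomial_function p"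
  shows "trig_poly (\<lambda>t. of_real (p (cis (2 * pi * t))))"
  using assms
proof induction
  case (linear f)
  interpret bounded_linear f by fact
  have f: "f z = Re z * f 1 + Im z * f \<i>" for z
  proof -
    have "f z = f (Re z *\<^sub>R 1 + Im z *\<^sub>R \<i>)"
      by (rule arg_cong[of _ _ f]) (simp add: complex_eq_iff)
    thus ?thesis by (simp only: add scaleR real_scaleR_def)
  qed
  \<comment> \<open>With this \<open>z\<close>, twice the real part of \<open>z * cis t\<close> is
    \<open>f 1 * cos t + f \<i> * sin t\<close>.\<close>
  define z where "z = Complex (f 1 / 2) (- f \<i> / 2)"
  have "(\<lambda>t. of_real (f (cis (2 * pi * t))))
      = (\<lambda>t. z * cis (2 * pi * (of_int 1 * t)) + cnj z * cis (2 * pi * (of_int (-1) * t)))"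
    by (rule ext) (simp add: f[of "cis _"] z_def complex_eq_iff algebra_simps)
  with trig_poly.add[OF trig_poly.monom[of z 1] trig_poly.monom[of "cnj z" "-1"]]
  show ?case by (simp only:)
next
  case (const c)
  show ?case using trig_poly.monom[of "of_real c" 0] by simp
next
  case (add f g)
  from trig_poly.add[OF this(3,4)] show ?case by simp
next
  case (mult f g)
  from trig_poly_mult[OF this(3,4)] show ?case by simp
qed

lemma Weyl_trig_poly:
  assumes x: "\<And>m::int. m \<noteq> 0 \<Longrightarrow> avg (\<lambda>n. cis (2 * pi * (of_int m * x n))) \<longlonglongrightarrow> 0"
    and f: "trig_poly f"
  shows "\<exists>I. (f has_integral I) {0..1} \<and> avg (\<lambda>n. f (x n)) \<longlonglongrightarrow> I"
  using f
proof induction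
  case (monom z m)
  show ?case
  proof (cases "m = 0")
    case True
    have "((\<lambda>t. z) has_integral z) {0..1::real}"
      using has_integral_const_real[of z 0 1] by simp
    moreover have "avg (\<lambda>n. z) \<longlonglongrightarrow> z"
      by (intro tendsto_eventually eventually_mono[OF eventually_gt_at_top[of 0]] avg_const)
    ultimately show ?thesis using True by auto
  next
    case False
    define A where "A t = z / (2 * pi * \<i> * of_int m) * cis (2 * pi * (of_int m * t))" for t
    have "(A has_vector_derivative z * cis (2 * pi * (of_int m * t))) (at t within {0..1})" for t
      unfolding A_def[abs_def] has_vector_derivative_def using False
      by (auto intro!: derivative_eq_intros simp: scaleR_conv_of_real field_simps)
    hence "((\<lambda>t. z * cis (2 * pi * (of_int m * t))) has_integral (A 1 - A 0)) {0..1}"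
      by (intro fundamental_theorem_of_calculus) auto
    moreover have "A 1 = A 0"
      by (simp add: A_def)
    moreover have "avg (\<lambda>n. z * cis (2 * pi * (of_int m * x n))) \<longlonglongrightarrow> z * 0"
      unfolding avg_cmult using False by (intro tendsto_mult_left x)
    ultimately show ?thesis by auto
  qed
next
  case (add f g)
  then obtain I J where "(f has_integral I) {0..1}" "avg (\<lambda>n. f (x n)) \<longlonglongrightarrow> I"
    "(g has_integral J) {0..1}" "avg (\<lambda>n. g (x n)) \<longlonglongrightarrow> J"
    by blast
  thus ?case
    by (intro exI[of _ "I + J"] conjI has_integral_add) (auto simp: avg_add intro!: tendsto_add)
qed

lemma Weyl_real_polynomial_function:
  assumes x: "\<And>m::int. m \<noteq> 0 \<Longrightarrow> avg (\<lambda>n. cis (2 * pi * (of_int m * x n))) \<longlonglongrightarrow> 0"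
    and p: "real_polynomial_function p"
  shows "avg (\<lambda>n. p (cis (2 * pi * x n))) \<longlonglongrightarrow> integral {0..1} (\<lambda>t. p (cis (2 * pi * t)))"
proof -
  obtain I where I: "((\<lambda>t. complex_of_real (p (cis (2 * pi * t)))) has_integral I) {0..1}"
    "avg (\<lambda>n. complex_of_real (p (cis (2 * pi * x n)))) \<longlonglongrightarrow> I"
    using Weyl_trig_poly[OF x trig_poly_real_polynomial_function[OF p]] by blast
  have "((\<lambda>t. p (cis (2 * pi * t))) has_integral Re I) {0..1}"
    using has_integral_Re[OF I(1)] by simp
  hence "integral {0..1} (\<lambda>t. p (cis (2 * pi * t))) = Re I"
    by (rule integral_unique)
  moreover have "(\<lambda>N. Re (avg (\<lambda>n. complex_of_real (p (cis (2 * pi * x n)))) N)) \<longlonglongrightarrow> Re I"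
    using I(2) by (rule tendsto_Re)
  hence "avg (\<lambda>n. p (cis (2 * pi * x n))) \<longlonglongrightarrow> Re I"
    by (simp add: avg_def[abs_def])
  ultimately show ?thesis by simp
qed

lemma continuous_on_cis_circle:
  fixes g :: "complex \<Rightarrow> real"
  assumes "continuous_on (sphere 0 1) g"
  shows "continuous_on A (\<lambda>t. g (cis (2 * pi * t)))"
proof (rule continuous_on_compose2[OF assms])
  show "continuous_on A (\<lambda>t. cis (2 * pi * t))"
    by (intro continuous_intros)
qed auto

text \<open>Working on the circle turns periodic functions into functions on a compact set. A
  one-sided estimate suffices, since upper bounds for all residue classes will force the
  limits.\<close>

lemma Weyl_continuous_upper:
  fixes g :: "complex \<Rightarrow> real"
  assumes x: "\<And>m::int. m \<noteq> 0 \<Longrightarrow> avg (\<lambda>n. cis (2 * pi * (of_int m * x n))) \<longlonglongrightarrow> 0"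
    and g: "continuous_on (sphere 0 1) g" and \<epsilon>: "\<epsilon> > 0"
  shows "\<forall>\<^sub>F N in sequentially.
    avg (\<lambda>n. g (cis (2 * pi * x n))) N \<le> integral {0..1} (\<lambda>t. g (cis (2 * pi * t))) + \<epsilon>"
proof -
  \<comment> \<open>One \<open>\<delta>\<close> each for the integral of \<open>p\<close>, the
    passage to the limit and the comparison of the means.\<close>
  define \<delta> where "\<delta> = \<epsilon> / 3"
  have \<delta>: "\<delta> > 0" using \<epsilon> by (simp add: \<delta>_def)
  obtain p where p: "real_polynomial_function p" "\<And>z. z \<in> sphere 0 1 \<Longrightarrow> \<bar>g z - p z\<bar> < \<delta>"
    using Stone_Weierstrass_real_polynomial_function[OF compact_sphere g \<delta>] by blast
  have close: "\<bar>g (cis t) - p (cis t)\<bar> < \<delta>" for t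
    by (rule p) simp
  have p_le: "p (cis t) \<le> g (cis t) + \<delta>" for t
    using close[of t] by linarith
  have "continuous_on (sphere 0 1) p"
    using p(1) by (simp add: continuous_on_polymonial_function real_polynomial_function_eq)
  hence "integral {0..1} (\<lambda>t. p (cis (2 * pi * t)))
      \<le> integral {0..1} (\<lambda>t. g (cis (2 * pi * t)) + \<delta>)"
    using g
    by (intro integral_le integrable_continuous_real continuous_on_add continuous_on_cis_circle
        continuous_on_const p_le)
  also have "\<dots> = integral {0..1} (\<lambda>t. g (cis (2 * pi * t))) + \<delta>"
    using g by (subst integral_add) (auto intro!: integrable_continuous_real continuous_on_cis_circle)
  finally have "\<forall>\<^sub>F N in sequentially.
    avg (\<lambda>n. p (cis (2 * pi * x n))) N < integral {0..1} (\<lambda>t. g (cis (2 * pi * t))) + 2 * \<delta>"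
    using \<delta> by (intro order_tendstoD(2)[OF Weyl_real_polynomial_function[OF x p(1)]]) auto
  with eventually_gt_at_top[of 0] show ?thesis
  proof eventually_elim
    case (elim N)
    have "avg (\<lambda>n. g (cis (2 * pi * x n))) N \<le> avg (\<lambda>n. p (cis (2 * pi * x n)) + \<delta>) N"
    proof (rule avg_mono)
      fix n show "g (cis (2 * pi * x n)) \<le> p (cis (2 * pi * x n)) + \<delta>"
        using close[of "2 * pi * x n"] by linarith
    qed
    also have "\<dots> = avg (\<lambda>n. p (cis (2 * pi * x n))) N + \<delta>"
      using elim by (simp add: avg_add avg_const)
    finally show ?case using elim by (simp add: \<delta>_def)
  qed
qed

text \<open>The arc is closed, so its indicator function is the pointwise limit of the continuous
  functions \<open>max 0 (1 - j dist(z, C))\<close> lying above it.\<close>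

lemma Weyl_arc_upper:
  assumes x: "\<And>m::int. m \<noteq> 0 \<Longrightarrow> avg (\<lambda>n. cis (2 * pi * (of_int m * x n))) \<longlonglongrightarrow> 0"
    and \<alpha>\<beta>: "0 \<le> \<alpha>" "\<alpha> \<le> \<beta>" "\<beta> \<le> 1" and \<epsilon>: "\<epsilon> > 0"
  shows "\<forall>\<^sub>F N in sequentially.
    avg (\<lambda>n. of_bool (cis (2 * pi * x n) \<in> (\<lambda>t. cis (2 * pi * t)) ` {\<alpha>..\<beta>})) N \<le> \<beta> - \<alpha> + \<epsilon>"
proof -
  define C where "C = (\<lambda>t. cis (2 * pi * t)) ` {\<alpha>..\<beta>}"
  have "compact C"
    unfolding C_def by (intro compact_continuous_image continuous_intros) auto
  hence C: "closed C" "C \<noteq> {}"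
    using \<alpha>\<beta> by (auto simp: C_def compact_imp_closed)
  define g where "g j z = max 0 (1 - real j * infdist z C)" for j z
  have g_cont: "continuous_on A (g j)" for A j
    unfolding g_def[abs_def] by (intro continuous_intros)
  have g_lim: "(\<lambda>j. g j z) \<longlonglongrightarrow> of_bool (z \<in> C)" for z
  proof (cases "z \<in> C")
    case True
    thus ?thesis by (simp add: g_def)
  next
    case False
    hence "infdist z C > 0"
      using C infdist_pos_not_in_closed by blast
    hence "(\<lambda>j. max 0 (1 - real j * infdist z C)) \<longlonglongrightarrow> 0"
      by real_asymp
    thus ?thesis using False by (simp add: g_def)
  qed
  have g_bound: "norm (g j z) \<le> 1" for j z
    using infdist_nonneg[of z C] by (auto simp: g_def max_def)
  have g_ge: "of_bool (z \<in> C) \<le> g j z" for j z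
    by (simp add: g_def)
  \<comment> \<open>The endpoints 0 and 1 give the same point of the circle, so the equivalence
    needs the open interval; the integrals do not change.\<close>
  have in_C: "cis (2 * pi * t) \<in> C \<longleftrightarrow> t \<in> {\<alpha>..\<beta>}" if "t \<in> {0<..<1}" for t
  proof
    assume "cis (2 * pi * t) \<in> C"
    then obtain s where s: "s \<in> {\<alpha>..\<beta>}" "cis (2 * pi * t) = cis (2 * pi * s)"
      by (auto simp: C_def)
    then obtain n :: int where "2 * pi * t = 2 * pi * s + 2 * pi * n"
      using sin_cos_eq_iff[of "2 * pi * t" "2 * pi * s"] by (auto simp: complex_eq_iff)
    hence n: "t = s + n"
      by (metis distrib_left mult_cancel_left pi_neq_zero zero_neq_numeral mult_eq_0_iff)
    hence "n = 0"
      using s(1) that \<alpha>\<beta> by auto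
    with n s show "t \<in> {\<alpha>..\<beta>}" by simp
  qed (auto simp: C_def)
  have "(\<lambda>j. integral {0<..<1} (\<lambda>t. g j (cis (2 * pi * t))))
      \<longlonglongrightarrow> integral {0<..<1} (\<lambda>t. of_bool (cis (2 * pi * t) \<in> C))"
  proof (rule dominated_convergence(2))
    show "(\<lambda>t. g j (cis (2 * pi * t))) integrable_on {0<..<1}" for j
      unfolding integrable_on_open_interval_real
      by (intro integrable_continuous_real continuous_on_cis_circle g_cont)
    show "(\<lambda>_. 1 :: real) integrable_on {0<..<1::real}"
      unfolding integrable_on_open_interval_real by (rule integrable_const_ivl)
  qed (use g_bound g_lim in auto)
  also have "integral {0<..<1} (\<lambda>t. of_bool (cis (2 * pi * t) \<in> C) :: real)
      = integral {0<..<1} (\<lambda>t. if t \<in> {\<alpha>..\<beta>} then 1 else 0)"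
    by (intro integral_cong) (auto simp: in_C)
  also have "\<dots> = integral {0..1} (\<lambda>t. if t \<in> {\<alpha>..\<beta>} then 1 else 0)"
    by (rule integral_open_interval_real [symmetric])
  also have "\<dots> = \<beta> - \<alpha>"
    using \<alpha>\<beta> has_integral_const_real[of "1::real" \<alpha> \<beta>]
    by (intro integral_unique) (subst has_integral_restrict, auto)
  finally have "\<forall>\<^sub>F j in sequentially. integral {0<..<1} (\<lambda>t. g j (cis (2 * pi * t))) < \<beta> - \<alpha> + \<epsilon> / 2"
    using \<epsilon> by (intro order_tendstoD(2)) auto
  then obtain j where j: "integral {0..1} (\<lambda>t. g j (cis (2 * pi * t))) < \<beta> - \<alpha> + \<epsilon> / 2"
    unfolding integral_open_interval_real eventually_at_top_linorder by blast
  have "\<forall>\<^sub>F N in sequentially. avg (\<lambda>n. g j (cis (2 * pi * x n))) N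
      \<le> integral {0..1} (\<lambda>t. g j (cis (2 * pi * t))) + \<epsilon> / 2"
    using \<epsilon> by (intro Weyl_continuous_upper x g_cont) auto
  thus ?thesis
  proof eventually_elim
    case (elim N)
    have "avg (\<lambda>n. of_bool (cis (2 * pi * x n) \<in> C)) N \<le> avg (\<lambda>n. g j (cis (2 * pi * x n))) N"
      by (intro avg_mono g_ge)
    with elim j show ?case by (simp add: C_def)
  qed
qed

section \<open>Equidistribution in residue classes\<close>

definition equidistributed_mod :: "(nat \<Rightarrow> nat) \<Rightarrow> bool" where
  "equidistributed_mod s \<longleftrightarrow>
     (\<forall>q>0. \<forall>r<q. avg (\<lambda>n. of_bool (s n mod q = r)) \<longlonglongrightarrow> 1 / real q)"

lemma avg_sum: "avg (\<lambda>n. \<Sum>i\<in>A. f i n) N = (\<Sum>i\<in>A. avg (f i) N)"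
  unfolding avg_def by (subst sum.swap) (rule sum_divide_distrib)

lemma sum_of_bool_eq: "finite A \<Longrightarrow> (\<Sum>r\<in>A. of_bool (y = r)) = (of_bool (y \<in> A) :: real)"
  by (simp add: of_bool_def)

text \<open>The proportions of the \<open>q\<close> classes add up to 1, so upper bounds for the
  other classes give the lower bound for \<open>r\<close>.\<close>

lemma equidistributed_modI:
  assumes "\<And>q r \<epsilon>. 0 < q \<Longrightarrow> r < q \<Longrightarrow> \<epsilon> > 0 \<Longrightarrow>
    \<forall>\<^sub>F N in sequentially. avg (\<lambda>n. of_bool (s n mod q = r)) N \<le> 1 / real q + \<epsilon>"
  shows "equidistributed_mod s"
  unfolding equidistributed_mod_def
proof (intro allI impI)
  fix q r :: nat assume q: "0 < q" and r: "r < q"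
  define v :: "nat \<Rightarrow> nat \<Rightarrow> real" where "v r = avg (\<lambda>n. of_bool (s n mod q = r))" for r
  show "avg (\<lambda>n. of_bool (s n mod q = r)) \<longlonglongrightarrow> 1 / real q"
  proof (rule tendstoI, unfold v_def[symmetric])
    fix \<epsilon> :: real assume \<epsilon>: "\<epsilon> > 0"
    \<comment> \<open>The other \<open>q - 1\<close> classes together exceed their share by at most
      \<open>(q - 1) * \<delta>\<close>, which is below \<open>\<epsilon> / 2\<close>.\<close>
    define \<delta> where "\<delta> = \<epsilon> / (2 * real q)"
    have \<delta>: "\<delta> > 0" using \<epsilon> q by (simp add: \<delta>_def)
    have "\<forall>\<^sub>F N in sequentially. \<forall>r'\<in>{..<q}. v r' N \<le> 1 / real q + \<delta>"
      unfolding v_def using q \<delta> assms by (intro eventually_ball_finite) auto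
    with eventually_gt_at_top[of 0]
    show "\<forall>\<^sub>F N in sequentially. dist (v r N) (1 / real q) < \<epsilon>"
    proof eventually_elim
      case (elim N)
      have "(\<Sum>r'<q. v r' N) = avg (\<lambda>n. 1) N"
        using q unfolding v_def by (simp add: sum_of_bool_eq flip: avg_sum)
      hence "1 = (\<Sum>r'<q. v r' N)"
        using elim by (simp add: avg_const)
      also have "\<dots> = v r N + (\<Sum>r'\<in>{..<q}-{r}. v r' N)"
        using r by (subst sum.remove[of _ r]) auto
      also have "(\<Sum>r'\<in>{..<q}-{r}. v r' N) \<le> real (card ({..<q}-{r})) * (1 / real q + \<delta>)"
        using elim by (intro sum_bounded_above) auto
      also have "real (card ({..<q}-{r})) = real q - 1"
        using r by (simp add: of_nat_diff)
      finally have "v r N \<ge> 1 / real q - real q * \<delta> + \<delta>"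
        using q by (simp add: field_simps)
      moreover have "real q * \<delta> = \<epsilon> / 2"
        using q by (simp add: \<delta>_def)
      moreover have "v r N \<le> 1 / real q + \<delta>"
        using elim r by auto
      moreover have "\<delta> \<le> \<epsilon> / 2"
        unfolding \<delta>_def using q \<epsilon> by (intro divide_left_mono) auto
      ultimately show ?case
        using \<delta> \<epsilon> by (simp add: dist_real_def abs_less_iff)
    qed
  qed
qed

text \<open>If \<open>\<lfloor>y n\<rfloor>\<close> is in the class \<open>r\<close>, then
  \<open>y n / q\<close> modulo 1 lies in an arc of length \<open>1 / q\<close>. Only upper bounds
  are required, so the arc may be taken closed although its right end belongs to the next
  class.\<close>

lemma equidistributed_mod_floor:
  fixes y :: "nat \<Rightarrow> real"
  assumes y: "\<And>n. y n \<ge> 0"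
    and exp_avg: "\<And>\<theta>. \<theta> \<noteq> 0 \<Longrightarrow> avg (\<lambda>n. cis (2 * pi * (\<theta> * y n))) \<longlonglongrightarrow> 0"
  shows "equidistributed_mod (\<lambda>n. nat \<lfloor>y n\<rfloor>)"
proof (rule equidistributed_modI)
  fix q r :: nat and \<epsilon> :: real assume q: "0 < q" and r: "r < q" and \<epsilon>: "\<epsilon> > 0"
  define C where "C = (\<lambda>t. cis (2 * pi * t)) ` {real r / real q..(real r + 1) / real q}"
  have le: "of_bool (nat \<lfloor>y n\<rfloor> mod q = r) \<le> (of_bool (cis (2 * pi * (y n / real q)) \<in> C) :: real)" for n
  proof (cases "nat \<lfloor>y n\<rfloor> mod q = r")
    case True
    \<comment> \<open>\<open>b\<close> is the integer part of \<open>y n / q\<close>; removing it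
      does not move the point on the circle.\<close>
    define b where "b = nat \<lfloor>y n\<rfloor> div q"
    define t where "t = y n / real q - real b"
    have "nat \<lfloor>y n\<rfloor> = b * q + r"
      using True unfolding b_def by (metis div_mult_mod_eq)
    hence "real b * real q + real r = real_of_int \<lfloor>y n\<rfloor>"
      using y[of n] by (metis nat_0_le of_nat_add of_nat_mult of_int_of_nat_eq zero_le_floor)
    hence "real b * real q + real r \<le> y n" "y n \<le> real b * real q + real r + 1"
      by linarith+
    moreover have "t = (y n - real b * real q) / real q"
      using q by (simp add: t_def field_simps)
    ultimately have "t \<in> {real r / real q..(real r + 1) / real q}"
      using q by (auto intro!: divide_right_mono)
    moreover have "2 * pi * (y n / real q) = 2 * pi * t + 2 * pi * real b"
      by (simp add: t_def right_diff_distrib)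
    hence "cis (2 * pi * (y n / real q)) = cis (2 * pi * t) * cis (2 * pi * real b)"
      by (simp only: cis_mult)
    hence "cis (2 * pi * (y n / real q)) = cis (2 * pi * t)"
      by simp
    ultimately show ?thesis by (auto simp: C_def)
  qed simp
  \<comment> \<open>Frequency \<open>m\<close> for \<open>y n / q\<close> is frequency
    \<open>m / q\<close> for \<open>y n\<close>, which is why \<open>\<theta>\<close> ranges over
    the reals.\<close>
  have "avg (\<lambda>n. cis (2 * pi * (of_int m * (y n / real q)))) \<longlonglongrightarrow> 0" if "m \<noteq> 0" for m
    using exp_avg[of "of_int m / real q"] that q
    unfolding times_divide_eq_left times_divide_eq_right by simp
  hence "\<forall>\<^sub>F N in sequentially. avg (\<lambda>n. of_bool (cis (2 * pi * (y n / real q)) \<in> C)) N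
      \<le> (real r + 1) / real q - real r / real q + \<epsilon>"
    unfolding C_def using q r \<epsilon> by (intro Weyl_arc_upper) (auto intro: divide_right_mono)
  thus "\<forall>\<^sub>F N in sequentially. avg (\<lambda>n. of_bool (nat \<lfloor>y n\<rfloor> mod q = r)) N \<le> 1 / real q + \<epsilon>"
  proof eventually_elim
    case (elim N)
    have "avg (\<lambda>n. of_bool (nat \<lfloor>y n\<rfloor> mod q = r) :: real) N
        \<le> avg (\<lambda>n. of_bool (cis (2 * pi * (y n / real q)) \<in> C)) N"
      by (rule avg_mono[OF le])
    with elim show ?case by (simp add: add_divide_distrib)
  qed
qed

lemma equidistributed_mod_id: "equidistributed_mod (\<lambda>n. n)"
proof (rule equidistributed_modI)
  fix q r :: nat and \<epsilon> :: real assume q: "0 < q" and r: "r < q" and \<epsilon>: "\<epsilon> > 0"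
  \<comment> \<open>Each of the \<open>m\<close> complete blocks contains the residue
    \<open>r\<close> once, the last block at most once more.\<close>
  have count: "(\<Sum>n<q * m + i. of_bool (n mod q = r)) \<le> real (m + 1)" if "i \<le> q" for m i
  proof -
    have "{n. n < q * m + i \<and> n mod q = r} \<subseteq> (\<lambda>b. b * q + r) ` {..m}"
    proof
      fix n assume n: "n \<in> {n. n < q * m + i \<and> n mod q = r}"
      hence "n < q * (m + 1)" using that by simp
      hence "n div q \<le> m"
        using q by (metis Suc_eq_plus1 less_Suc_eq_le less_mult_imp_div_less mult.commute)
      with n show "n \<in> (\<lambda>b. b * q + r) ` {..m}"
        by (auto intro!: image_eqI[of _ _ "n div q"])
    qed
    hence "card {n. n < q * m + i \<and> n mod q = r} \<le> card ((\<lambda>b. b * q + r) ` {..m})"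
      by (intro card_mono) auto
    also have "\<dots> \<le> m + 1"
      using card_image_le[of "{..m}"] by simp
    finally show ?thesis
      by (simp add: Int_def lessThan_def)
  qed
  have "\<forall>\<^sub>F N in sequentially. 1 / real N < \<epsilon>"
    using \<epsilon> by (intro order_tendstoD(2)[where y = 0]) (real_asymp | simp)+
  with eventually_gt_at_top[of 0]
  show "\<forall>\<^sub>F N in sequentially. avg (\<lambda>n. of_bool (n mod q = r)) N \<le> 1 / real q + \<epsilon>"
  proof eventually_elim
    case (elim N)
    have "(\<Sum>n<N. of_bool (n mod q = r)) \<le> real (N div q + 1)"
      using count[of "N mod q" "N div q"] q by (simp add: less_imp_le)
    also have "\<dots> \<le> real N / real q + 1"
      by (simp add: of_nat_div_le_of_nat)
    finally have "avg (\<lambda>n. of_bool (n mod q = r)) N \<le> (real N / real q + 1) / real N"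
      unfolding avg_def by (intro divide_right_mono) auto
    also have "\<dots> = 1 / real q + 1 / real N"
      using elim q by (simp add: field_simps)
    finally show ?case using elim by linarith
  qed
qed

section \<open>Frequencies of approximately periodic sequences\<close>

lemma has_frequency_iff_avg:
  "has_frequency b \<alpha> d \<longleftrightarrow> avg (\<lambda>n. of_bool (b n = \<alpha>)) \<longlonglongrightarrow> d"
proof -
  have "real (card {n. n < N \<and> b n = \<alpha>}) / real N = avg (\<lambda>n. of_bool (b n = \<alpha>)) N" for N
    by (simp add: avg_def Int_def)
  thus ?thesis unfolding has_frequency_def by simp
qed

text \<open>The exceptional set consists of residue classes modulo the same \<open>q\<close>, so
  every sequence equidistributed modulo \<open>q\<close> meets it with the same small
  density.\<close>

definition approx_periodic :: "(nat \<Rightarrow> 'a) \<Rightarrow> bool" where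
  "approx_periodic a \<longleftrightarrow> (\<forall>\<epsilon>>0. \<exists>q>0. \<exists>B\<subseteq>{..<q}.
     real (card B) \<le> \<epsilon> * real q \<and> (\<forall>n. n mod q \<notin> B \<longrightarrow> a n = a (n mod q)))"

lemma approx_periodic_avg:
  fixes \<epsilon> :: real
  assumes a: "approx_periodic a" and \<epsilon>: "\<epsilon> > 0"
  obtains g where "\<And>s. equidistributed_mod s \<Longrightarrow>
    \<forall>\<^sub>F N in sequentially. \<bar>avg (\<lambda>n. of_bool (a (s n) = \<alpha>)) N - g\<bar> < \<epsilon>"
proof -
  from a \<epsilon> obtain q B where q: "q > 0" and B: "B \<subseteq> {..<q}" "real (card B) \<le> \<epsilon> / 2 * real q"
    and per: "\<And>n. n mod q \<notin> B \<Longrightarrow> a n = a (n mod q)"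
    unfolding approx_periodic_def by (meson half_gt_zero)
  \<comment> \<open>The occurrences of \<open>\<alpha>\<close> lie between the classes in
    \<open>G\<close> and those in \<open>G \<union> B\<close>, where \<open>B\<close> adds at most
    \<open>\<epsilon> / 2\<close>. The witness for \<open>g\<close> is \<open>card G / q\<close>,
    which does not depend on \<open>s\<close>.\<close>
  define G where "G = {r\<in>{..<q} - B. a r = \<alpha>}"
  have fin: "finite B" "finite G" and disj: "G \<inter> B = {}" and sub: "G \<subseteq> {..<q}"
    using B finite_subset by (auto simp: G_def)
  show ?thesis
  proof
    fix s assume s: "equidistributed_mod s"
    have lim: "avg (\<lambda>n. of_bool (s n mod q \<in> X)) \<longlonglongrightarrow> real (card X) / real q"
      if "X \<subseteq> {..<q}" for X
    proof -
      have "finite X" using that finite_subset by blast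
      have "(\<lambda>N. \<Sum>r\<in>X. avg (\<lambda>n. of_bool (s n mod q = r)) N) \<longlonglongrightarrow> (\<Sum>r\<in>X. 1 / real q)"
        using s q that unfolding equidistributed_mod_def by (intro tendsto_sum) blast
      thus ?thesis
        unfolding avg_sum[symmetric] sum_of_bool_eq[OF \<open>finite X\<close>] sum_constant by simp
    qed
    have "real (card (G \<union> B)) / real q = real (card G) / real q + real (card B) / real q"
      using fin disj by (simp add: card_Un_disjoint add_divide_distrib)
    also have "real (card B) / real q \<le> \<epsilon> / 2"
      using B(2) q by (simp add: pos_divide_le_eq)
    finally have card_GB: "real (card (G \<union> B)) / real q \<le> real (card G) / real q + \<epsilon> / 2" by simp
    have "\<forall>\<^sub>F N in sequentially. avg (\<lambda>n. of_bool (s n mod q \<in> G)) N > real (card G) / real q - \<epsilon>"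
      using \<epsilon> by (intro order_tendstoD(1)[OF lim[OF sub]]) auto
    moreover have "\<forall>\<^sub>F N in sequentially.
        avg (\<lambda>n. of_bool (s n mod q \<in> G \<union> B)) N < real (card G) / real q + \<epsilon>"
      using \<epsilon> card_GB B(1) sub by (intro order_tendstoD(2)[OF lim]) auto
    ultimately show "\<forall>\<^sub>F N in sequentially.
        \<bar>avg (\<lambda>n. of_bool (a (s n) = \<alpha>)) N - real (card G) / real q\<bar> < \<epsilon>"
    proof eventually_elim
      case (elim N)
      have "avg (\<lambda>n. of_bool (s n mod q \<in> G)) N \<le> (avg (\<lambda>n. of_bool (a (s n) = \<alpha>)) N :: real)"
      proof (rule avg_mono)
        fix n show "of_bool (s n mod q \<in> G) \<le> (of_bool (a (s n) = \<alpha>) :: real)"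
          using per[of "s n"] by (auto simp: G_def)
      qed
      moreover have "(avg (\<lambda>n. of_bool (a (s n) = \<alpha>)) N :: real)
          \<le> avg (\<lambda>n. of_bool (s n mod q \<in> G \<union> B)) N"
      proof (rule avg_mono)
        fix n show "(of_bool (a (s n) = \<alpha>) :: real) \<le> of_bool (s n mod q \<in> G \<union> B)"
          using per[of "s n"] q by (auto simp: G_def)
      qed
      ultimately show ?case using elim by linarith
    qed
  qed
qed

text \<open>For each \<open>\<epsilon>\<close> one \<open>g\<close> is close to the means along
  every equidistributed \<open>s\<close>. Along the identity this makes the means a Cauchy sequence;
  comparing any other \<open>s\<close> with the identity through the same \<open>g\<close> yields
  the same limit.\<close>

lemma approx_periodic_frequency:
  assumes "approx_periodic a"
  shows "\<exists>d. \<forall>s. equidistributed_mod s \<longrightarrow> has_frequency (\<lambda>n. a (s n)) \<alpha> d"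
proof -
  define F :: "(nat \<Rightarrow> nat) \<Rightarrow> nat \<Rightarrow> real" where "F s = avg (\<lambda>n. of_bool (a (s n) = \<alpha>))" for s
  have approx: "\<exists>g. \<forall>s. equidistributed_mod s \<longrightarrow> (\<forall>\<^sub>F N in sequentially. \<bar>F s N - g\<bar> < \<epsilon>)"
    if "\<epsilon> > 0" for \<epsilon>
    using approx_periodic_avg[OF assms that, of \<alpha>] unfolding F_def by metis
  have "Cauchy (F (\<lambda>n. n))"
  proof (rule metric_CauchyI)
    fix \<epsilon> :: real assume "\<epsilon> > 0"
    then obtain g where "\<forall>\<^sub>F N in sequentially. \<bar>F (\<lambda>n. n) N - g\<bar> < \<epsilon> / 2"
      using approx[of "\<epsilon> / 2"] equidistributed_mod_id by auto
    then obtain N0 where N0: "\<bar>F (\<lambda>n. n) N - g\<bar> < \<epsilon> / 2" if "N \<ge> N0" for N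
      by (auto simp: eventually_at_top_linorder)
    have "dist (F (\<lambda>n. n) M) (F (\<lambda>n. n) N) < \<epsilon>" if "M \<ge> N0" "N \<ge> N0" for M N
      using N0[OF that(1)] N0[OF that(2)] unfolding dist_real_def by linarith
    thus "\<exists>N0. \<forall>M\<ge>N0. \<forall>N\<ge>N0. dist (F (\<lambda>n. n) M) (F (\<lambda>n. n) N) < \<epsilon>"
      by blast
  qed
  then obtain d where d: "F (\<lambda>n. n) \<longlonglongrightarrow> d"
    by (auto simp: Cauchy_convergent_iff convergent_def)
  have "F s \<longlonglongrightarrow> d" if s: "equidistributed_mod s" for s
  proof (rule Lim_transform2[OF d], rule tendstoI)
    fix \<epsilon> :: real assume "\<epsilon> > 0"
    then obtain g where "\<forall>\<^sub>F N in sequentially. \<bar>F (\<lambda>n. n) N - g\<bar> < \<epsilon> / 2"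
      "\<forall>\<^sub>F N in sequentially. \<bar>F s N - g\<bar> < \<epsilon> / 2"
      using approx[of "\<epsilon> / 2"] equidistributed_mod_id s by auto
    thus "\<forall>\<^sub>F N in sequentially. dist (F (\<lambda>n. n) N - F s N) 0 < \<epsilon>"
    proof eventually_elim
      case (elim N)
      thus ?case by (simp only: dist_real_def)
    qed
  qed
  thus ?thesis
    unfolding has_frequency_iff_avg F_def by blast
qed

section \<open>Synchronizing automata\<close>

text \<open>Unlike \<open>base_expansion\<close>, this pads with leading zeros up to length \<open>m\<close> and drops all
  digits but the last \<open>m\<close>.\<close>

fun digits :: "nat \<Rightarrow> nat \<Rightarrow> nat \<Rightarrow> nat list" where
  "digits k 0 n = []"
| "digits k (Suc m) n = digits k m (n div k) @ [n mod k]"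

lemma digits_mod: "digits k m (n mod k ^ m) = digits k m n"
proof (induction m arbitrary: n)
  case (Suc m)
  show ?case
  proof (cases "k = 0")
    case False
    have "n mod k ^ Suc m = k * (n div k mod k ^ m) + n mod k"
      by (simp add: mod_mult2_eq)
    thus ?thesis using Suc[of "n div k"] False by simp
  qed simp
qed simp

lemma digits_add: "digits k (m + l) n = digits k m (n div k ^ l) @ digits k l n"
  by (induction l arbitrary: n) (auto simp: div_mult2_eq)

lemma set_digits: "k > 0 \<Longrightarrow> set (digits k m n) \<subseteq> {..<k}"
  by (induction m arbitrary: n) auto

lemma digits_surj:
  assumes "set w \<subseteq> {..<k}"
  shows "\<exists>n<k ^ length w. digits k (length w) n = w"
  using assms
proof (induction w rule: rev_induct)
  case (snoc d w)
  then obtain n where n: "n < k ^ length w" "digits k (length w) n = w" and d: "d < k"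
    by auto
  have "d + k * n < k * Suc n"
    using d by simp
  also have "\<dots> \<le> k * k ^ length w"
    using n(1) by (intro mult_le_mono2) simp
  finally show ?case
    using n d by (intro exI[of _ "d + k * n"]) simp
qed simp

section \<open>Runs of the automaton on expansions\<close>

lemma run_append: "run M q (u @ v) = run M (run M q u) v"
  by (simp add: run_def)

lemma run_in_states:
  assumes "dfao k M" "q \<in> states M" "set w \<subseteq> {..<k}"
  shows "run M q w \<in> states M"
  using assms(2,3)
  by (induction w arbitrary: q) (use assms(1) in \<open>auto simp: run_def dfao_def\<close>)

lemma base_expansion_Suc_div:
  assumes "k \<ge> 2" "n > 0"
  shows "base_expansion k n = base_expansion k (n div k) @ [n mod k]"
  using assms by (subst base_expansion.simps) simp

lemma set_base_expansion:
  assumes "k \<ge> 2"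
  shows "set (base_expansion k n) \<subseteq> {..<k}"
proof (induction n rule: less_induct)
  case (less n)
  show ?case
  proof (cases "n = 0")
    case True
    thus ?thesis by (simp add: base_expansion.simps)
  next
    case False
    with less[of "n div k"] assms show ?thesis
      by (simp add: base_expansion_Suc_div)
  qed
qed

text \<open>The loop labelled 0 at the initial state absorbs leading zeros, so the last
  \<open>m\<close> digits can be split off even when the expansion of \<open>n\<close> is shorter
  than \<open>m\<close>.\<close>

lemma run_base_expansion_digits:
  assumes "k \<ge> 2" and "step M (init M) 0 = init M"
  shows "run M (init M) (base_expansion k n)
    = run M (run M (init M) (base_expansion k (n div k ^ m))) (digits k m n)"
proof (induction m arbitrary: n)
  case (Suc m)
  have "run M (init M) (base_expansion k n)
      = step M (run M (init M) (base_expansion k (n div k))) (n mod k)"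
  proof (cases "n = 0")
    case True
    thus ?thesis using assms(2) by (simp add: base_expansion.simps run_def)
  next
    case False
    thus ?thesis using assms(1) by (simp add: base_expansion_Suc_div run_def)
  qed
  also have "run M (init M) (base_expansion k (n div k))
      = run M (run M (init M) (base_expansion k (n div k ^ Suc m))) (digits k m (n div k))"
    using Suc[of "n div k"] by (simp add: div_mult2_eq)
  finally show ?case by (simp add: run_append) (simp add: run_def)
qed (simp add: run_def)

section \<open>Counting the words that do not merge all states\<close>

definition collapsing :: "('q, 'a) automaton \<Rightarrow> nat list \<Rightarrow> bool" where
  "collapsing M u \<longleftrightarrow> (\<forall>q\<in>states M. \<forall>q'\<in>states M. run M q u = run M q' u)"

text \<open>Residues encode the words of length \<open>m\<close>; this will be the exceptional set
  \<open>B\<close> in \<open>approx_periodic\<close>.\<close>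

definition noncollapsing :: "nat \<Rightarrow> ('q, 'a) automaton \<Rightarrow> nat \<Rightarrow> nat set" where
  "noncollapsing k M m = {r. r < k ^ m \<and> \<not> collapsing M (digits k m r)}"

text \<open>If the first \<open>m\<close> or the last \<open>length w\<close> digits merge all
  states, so does the whole word. A surviving word therefore has a surviving prefix and a final
  block different from \<open>w\<close>.\<close>

lemma card_noncollapsing_add_le:
  assumes k: "k \<ge> 2" and M: "dfao k M" and w: "synchronizing_word k M w"
  shows "card (noncollapsing k M (m + length w)) \<le> card (noncollapsing k M m) * (k ^ length w - 1)"
proof -
  define L where "L = length w"
  obtain n0 where n0: "n0 < k ^ L" "digits k L n0 = w"
    using digits_surj w unfolding synchronizing_word_def L_def by blast
  have "collapsing M w"
    using w unfolding synchronizing_word_def collapsing_def by metis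
  have "(r div k ^ L, r mod k ^ L) \<in> noncollapsing k M m \<times> ({..<k ^ L} - {n0})"
    if "r \<in> noncollapsing k M (m + L)" for r
  proof -
    have r: "r < k ^ m * k ^ L"
      and nc: "\<not> collapsing M (digits k m (r div k ^ L) @ digits k L r)"
      using that by (auto simp: noncollapsing_def digits_add power_add)
    have "\<not> collapsing M (digits k m (r div k ^ L))"
      using nc by (auto simp: collapsing_def run_append) metis
    \<comment> \<open>The final block is known to merge elements of \<open>states M\<close> only, so
      the runs on the prefix must stay there.\<close>
    moreover have "run M q (digits k m (r div k ^ L)) \<in> states M" if "q \<in> states M" for q
      using k by (intro run_in_states[OF M that] set_digits) simp
    hence "\<not> collapsing M (digits k L r)"
      using nc by (auto simp: collapsing_def run_append)
    hence "digits k L (r mod k ^ L) \<noteq> w"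
      using \<open>collapsing M w\<close> by (auto simp: digits_mod)
    moreover have "r div k ^ L < k ^ m"
      using r by (rule less_mult_imp_div_less)
    ultimately show ?thesis
      using n0 k by (auto simp: noncollapsing_def)
  qed
  moreover have "inj_on (\<lambda>r. (r div k ^ L, r mod k ^ L)) (noncollapsing k M (m + L))"
    by (rule inj_onI) (metis div_mult_mod_eq prod.inject)
  ultimately have "card (noncollapsing k M (m + L))
      \<le> card (noncollapsing k M m \<times> ({..<k ^ L} - {n0}))"
    by (intro card_inj_on_le) (auto simp: noncollapsing_def)
  also have "\<dots> = card (noncollapsing k M m) * (k ^ L - 1)"
    using n0(1) by (simp add: card_cartesian_product)
  finally show ?thesis by (simp add: L_def)
qed

lemma card_noncollapsing_le:
  assumes "k \<ge> 2" "dfao k M" "synchronizing_word k M w"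
  shows "card (noncollapsing k M (j * length w)) \<le> (k ^ length w - 1) ^ j"
proof (induction j)
  \<comment> \<open>The empty word is the only word of length 0; the bound is 1 even for empty
    \<open>w\<close>, since \<open>0 ^ 0 = 1\<close>.\<close>
  case 0
  have "noncollapsing k M 0 \<subseteq> {0}"
    by (auto simp: noncollapsing_def)
  from card_mono[OF _ this] show ?case by simp
next
  case (Suc j)
  have "card (noncollapsing k M (Suc j * length w))
      \<le> card (noncollapsing k M (j * length w)) * (k ^ length w - 1)"
    using card_noncollapsing_add_le[OF assms, of "j * length w"] by (simp add: add.commute)
  also have "\<dots> \<le> (k ^ length w - 1) ^ j * (k ^ length w - 1)"
    by (intro mult_le_mono1 Suc)
  finally show ?case by (simp add: mult.commute)
qed

text \<open>Among the words made of \<open>j\<close> blocks, at most \<open>K - 1\<close> choices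
  per block out of \<open>K\<close> avoid merging, a proportion that tends to 0 with
  \<open>j\<close>. For all other residues the state before the last \<open>m\<close> digits is
  irrelevant, and \<open>n\<close> and \<open>n mod k ^ m\<close> share these digits.\<close>

lemma approx_periodic_synchronizing:
  assumes k: "k \<ge> 2" and gen: "generates_lz k M a" and w: "synchronizing_word k M w"
  shows "approx_periodic a"
  unfolding approx_periodic_def
proof (intro allI impI)
  fix \<epsilon> :: real assume \<epsilon>: "\<epsilon> > 0"
  have M: "dfao k M" and lz: "step M (init M) 0 = init M"
    and a: "\<And>n. a n = out M (run M (init M) (base_expansion k n))"
    using gen by (auto simp: generates_lz_def generates_def)
  define K where "K = k ^ length w"
  have K: "K > 0" using k by (simp add: K_def)
  have "(\<lambda>j. (real (K - 1) / real K) ^ j) \<longlonglongrightarrow> 0"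
    using K by (intro LIMSEQ_realpow_zero) auto
  hence "\<forall>\<^sub>F j in sequentially. (real (K - 1) / real K) ^ j < \<epsilon>"
    using \<epsilon> by (intro order_tendstoD(2)) auto
  then obtain j where j: "(real (K - 1) / real K) ^ j < \<epsilon>"
    by (auto simp: eventually_at_top_linorder)
  define m where "m = j * length w"
  have km: "k ^ m = K ^ j"
    by (simp add: m_def K_def mult.commute flip: power_mult)
  show "\<exists>q>0. \<exists>B\<subseteq>{..<q}. real (card B) \<le> \<epsilon> * real q \<and>
      (\<forall>n. n mod q \<notin> B \<longrightarrow> a n = a (n mod q))"
  proof (intro exI[of _ "k ^ m"] exI[of _ "noncollapsing k M m"] conjI allI impI)
    show "0 < k ^ m" using k by simp
    show "noncollapsing k M m \<subseteq> {..<k ^ m}" by (auto simp: noncollapsing_def)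
    have "real (card (noncollapsing k M m)) \<le> real ((K - 1) ^ j)"
      unfolding m_def K_def of_nat_le_iff by (rule card_noncollapsing_le[OF k M w])
    also have "\<dots> = (real (K - 1) / real K) ^ j * real (k ^ m)"
      using K by (simp add: km power_divide)
    also have "\<dots> \<le> \<epsilon> * real (k ^ m)"
      using j by (intro mult_right_mono) auto
    finally show "real (card (noncollapsing k M m)) \<le> \<epsilon> * real (k ^ m)" .
    fix n assume n: "n mod k ^ m \<notin> noncollapsing k M m"
    have run_n: "run M (init M) (base_expansion k i) \<in> states M" for i
      using M by (intro run_in_states[OF M _ set_base_expansion[OF k]]) (simp add: dfao_def)
    have "collapsing M (digits k m n)"
      using n k by (simp add: noncollapsing_def digits_mod)
    with run_n have collapse: "run M (run M (init M) (base_expansion k i)) (digits k m n)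
        = run M (run M (init M) (base_expansion k i')) (digits k m n)" for i i'
      by (auto simp: collapsing_def)
    show "a n = a (n mod k ^ m)"
      unfolding a run_base_expansion_digits[OF k lz, of n m]
        run_base_expansion_digits[OF k lz, of "n mod k ^ m" m] digits_mod
      by (rule arg_cong[OF collapse])
  qed
qed

theorem theorem1p1:
  fixes k :: nat and A :: "'a set" and a :: "nat \<Rightarrow> 'a" and c :: real
  assumes "k \<ge> 2"
    and "finite A" and "\<And>n. a n \<in> A"
    and "automatic k a" and "synchronizing k a"
    and "c > 1" and "c \<notin> \<int>"
  shows "\<forall>\<alpha>\<in>A. \<exists>d. has_frequency a \<alpha> d \<and>
           has_frequency (\<lambda>n. a (nat \<lfloor>real n powr c\<rfloor>)) \<alpha> d"
proof
  fix \<alpha>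
  have "approx_periodic a"
    using assms(1,5) approx_periodic_synchronizing
    unfolding synchronizing_def minimal_automaton_def by blast
  \<comment> \<open>One \<open>d\<close> serves all equidistributed sequences, hence both the
    identity and \<open>\<lfloor>n powr c\<rfloor>\<close>.\<close>
  from approx_periodic_frequency[OF this, of \<alpha>]
  obtain d where d: "\<forall>s. equidistributed_mod s \<longrightarrow> has_frequency (\<lambda>n. a (s n)) \<alpha> d"
    by (rule exE)
  have "equidistributed_mod (\<lambda>n. nat \<lfloor>real n powr c\<rfloor>)"
    using assms(6,7) by (intro equidistributed_mod_floor avg_cis_powr) auto
  with d[rule_format, of "\<lambda>n. nat \<lfloor>real n powr c\<rfloor>"] have "has_frequency (\<lambda>n. a (nat \<lfloor>real n powr c\<rfloor>)) \<alpha> d"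
    by simp
  moreover have "has_frequency a \<alpha> d"
    using d[rule_format, OF equidistributed_mod_id] by simp
  ultimately show "\<exists>d. has_frequency a \<alpha> d \<and> has_frequency (\<lambda>n. a (nat \<lfloor>real n powr c\<rfloor>)) \<alpha> d"
    by blast
qed

end
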